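(* Let $N_i\ge 1$, and let $u_i,h_i:\mathbb{R}^{2N_i+1}\to\mathbb{R}$ be $$u_i(\bm x_i)=(\bm x_i-\bm b_i)^T Q_i(\bm x_i-\bm b_i)+\bm\nu_i^T A_i\bm x_i,\qquad h_i(\bm x_i)=\bm q_i^T\bm x_i-\hat P_i^{H},$$ with data as in the context. Then the following three optimization problems have the following closed-form optimal solutions $\bm x_i^+$: (i) the solution of $\arg\min_{\bm x_i}u_i(\bm x_i)$ is $$\bm x_i^+=\bm b_i-\tfrac12 Q_i^{-1}A_i^T\bm\nu_i;$$ (ii) the solution of $\arg\min_{\bm x_i}\big(u_i(\bm x_i)+h_i(\bm x_i)\big)$ is $$\bm x_i^+=\bm b_i-\tfrac12 Q_i^{-1}\big(A_i^T\bm\nu_i+\bm q_i\big);$$ (iii) the solution of $\arg\min_{\bm x_i}u_i(\bm x_i)$ subject to $h_i(\bm x_i)=0$ is $$\bm x_i^+=\bm b_i-\tfrac12 Q_i^{-1}\left(A_i^T\bm\nu_i+\left(\bm q_i^T\,\frac{2Q_i\big(\bm b_i-\frac{\hat P_i^{H}}{\Vert\bm q_i\Vert^2}\bm q_i\big)-A_i^T\bm\nu_i}{\Vert\bm q_i\Vert^2}\right)\bm q_i\right).$$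
   Context: Each node $i$ of a network has $N_i\ge 1$ neighbors. Its local variable is $\bm x_i=[\bm o_i,\tilde{\bm o}_i,\hat\delta_i]\in\mathbb{R}^{N_i}\times\mathbb{R}^{N_i}\times\mathbb{R}$ (workload sent to each neighbor, workload received from each neighbor, and a scalar slack variable). The minimizations are over all of $\mathbb{R}^{2N_i+1}$ unless a constraint is written. $\Vert\cdot\Vert$ is the Euclidean norm. Data at node $i$: - $\bm b_i=[\bar{\bm w}_i,\tilde{\bm w}_i,0]\in\mathbb{R}^{2N_i+1}$ is a given vector, with $\bar{\bm w}_i,\tilde{\bm w}_i\in\mathbb{R}^{N_i}$. - $Q_i$ is the diagonal matrix with diagonal $(\tfrac{\rho}{2},\dots,\tfrac{\rho}{2},\hat c_i)$ ($2N_i$ entries equal to $\rho/2$, then $\hat c_i$), with $\rho>0$ and $\hat c_i>0$. - $\bm q_i=[(q_i^{tx}-q_i^{proc})\bm 1,\ (q_i^{rx}+q_i^{proc})\bm 1,\ 0]\in\mathbb{R}^{2N_i+1}$, where $\bm 1\in\mathbb{R}^{N_i}$ is the all-ones vector and $q_i^{tx},q_i^{rx},q_i^{proc}$ are the positive unit transmission, reception and processing costs (so $\bm q_i\neq\bm 0$; note that the last entry of $\bm q_i$, corresponding to $\hat\delta_i$, is $0$). - $\hat P_i^{H}\in\mathbb{R}$ is a given number (residual renewable power, possibly negative). - $\bm\nu_i$ is a given real vector of Lagrange multipliers and $A_i$ a given real matrix of compatible size with $2N_i+1$ columns. In the application, these are such that $\bm\nu_i^T A_i\bm x_i=\lambda_i\big[\bm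 1^T(\tilde{\bm o}_i-\bm o_i)-\hat\delta_i\big]-\bm\gamma_i^T\bm o_i-\tilde{\bm\gamma}_i^T\tilde{\bm o}_i+\bm\mu_i^T\bm o_i-\tilde{\bm\mu}_i^T\tilde{\bm o}_i-\hat\varphi_i\hat\delta_i$ for given multipliers $\lambda_i,\hat\varphi_i\in\mathbb{R}$ and $\bm\gamma_i,\tilde{\bm\gamma}_i,\bm\mu_i,\tilde{\bm\mu}_i\in\mathbb{R}^{N_i}$. *)

theory Defs
  imports "HOL-Analysis.Analysis"
begin

text \<open>Block vectors \<open>[o, o', \<delta>]\<close> of dimension \<open>2 * CARD('n) + 1\<close>: the index type is the disjoint
  sum of two copies of the neighbour index type \<open>'n\<close> and one extra index for the slack.\<close>

definition stack :: "real ^ 'n \<Rightarrow> real ^ 'n \<Rightarrow> real \<Rightarrow> real ^ ('n::finite + 'n + unit)" where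
  "stack v w s = (\<chi> k. case k of Inl i \<Rightarrow> v $ i | Inr (Inl i) \<Rightarrow> w $ i | Inr (Inr _) \<Rightarrow> s)"

definition diag_matrix :: "real ^ 'k \<Rightarrow> real ^ 'k ^ 'k" where
  "diag_matrix d = (\<chi> i j. if i = j then d $ i else 0)"

end

theory Submission
  imports Defs
begin

text \<open>A positive definite quadratic plus a linear term equals its value at a stationary point plus a
  positive definite form in the displacement, so the stationary point is the unique minimiser. For
  the constrained problem this is applied to the Lagrangian \<open>u + \<eta> h\<close>, which agrees with \<open>u\<close> on the
  constraint set; the multiplier \<open>\<eta>\<close> is explicit because the slack entry of \<open>q\<close> vanishes, which makes
  \<open>q\<close> an eigenvector of \<open>Q\<close>.\<close>

lemma is_arg_min_eq_singleton:
  fixes f :: "'a \<Rightarrow> 'b::linorder"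
  assumes "S x0" and "\<And>x. S x \<Longrightarrow> x \<noteq> x0 \<Longrightarrow> f x0 < f x"
  shows "{x. is_arg_min f S x} = {x0}"
  using assms unfolding is_arg_min_def by (auto dest: less_asym)

lemma diag_matrix_mult_nth: "(diag_matrix d *v x) $ i = d $ i * x $ i"
  by (simp add: diag_matrix_def matrix_vector_mult_def if_distrib[of "\<lambda>z. z * _"] cong: if_cong)

lemma transpose_diag_matrix: "transpose (diag_matrix d) = diag_matrix d"
  by (auto simp: diag_matrix_def transpose_def vec_eq_iff)

lemma diag_matrix_pos_def:
  assumes "\<And>i. d $ i > 0" and "x \<noteq> 0"
  shows "x \<bullet> (diag_matrix d *v x) > 0"
proof -
  obtain i where "x $ i \<noteq> 0"
    using assms(2) by (auto simp: vec_eq_iff)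
  then have "0 < x $ i * (d $ i * x $ i)"
    using assms(1)[of i] by (metis mult.left_commute mult_pos_pos not_real_square_gt_zero)
  moreover have "0 \<le> x $ j * (d $ j * x $ j)" for j
    using assms(1)[of j] by (metis less_imp_le mult.left_commute mult_nonneg_nonneg zero_le_square)
  ultimately have "0 < (\<Sum>j\<in>UNIV. x $ j * (d $ j * x $ j))"
    by (intro sum_pos2[of _ i]) auto
  then show ?thesis
    by (simp add: inner_vec_def diag_matrix_mult_nth)
qed

text \<open>Positive definiteness gives a trivial kernel, which for a square matrix already means
  invertibility.\<close>

lemma pos_def_mult_matrix_inv:
  fixes Q :: "real ^ 'k ^ 'k"
  assumes "\<And>x. x \<noteq> 0 \<Longrightarrow> x \<bullet> (Q *v x) > 0"
  shows "Q *v (matrix_inv Q *v v) = v"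
proof -
  have "\<forall>x. Q *v x = 0 \<longrightarrow> x = 0"
    using assms by force
  then have "invertible Q"
    by (simp add: invertible_left_inverse matrix_left_invertible_ker)
  then have "Q ** matrix_inv Q = mat 1"
    unfolding invertible_def matrix_inv_def by (rule someI2_ex) simp
  then show ?thesis
    by (simp add: matrix_vector_mul_assoc)
qed

text \<open>Expanding around \<open>x0\<close> leaves the cross term
  \<open>2 * ((Q *v (x0 - b)) \<bullet> (x - x0))\<close>, by symmetry of \<open>Q\<close>;
  stationarity makes \<open>g \<bullet> (x - x0)\<close> its exact negative.\<close>

lemma quadratic_expand_stationary:
  fixes Q :: "real ^ 'k ^ 'k"
  assumes "transpose Q = Q" and "2 *\<^sub>R (Q *v (x0 - b)) + g = 0"
  shows "(x - b) \<bullet> (Q *v (x - b)) + g \<bullet> x =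
    (x0 - b) \<bullet> (Q *v (x0 - b)) + g \<bullet> x0 + (x - x0) \<bullet> (Q *v (x - x0))"
proof -
  define y z where "y = x - x0" and "z = x0 - b"
  have g: "g = - (2 *\<^sub>R (Q *v z))"
    using assms(2) by (simp add: z_def eq_neg_iff_add_eq_0 add.commute)
  have sym: "z \<bullet> (Q *v y) = (Q *v z) \<bullet> y"
    by (metis assms(1) dot_lmul_matrix vector_transpose_matrix)
  have x: "x - b = z + y" "x = x0 + y" "x - x0 = y" "x0 - b = z"
    by (auto simp: y_def z_def)
  show ?thesis
    unfolding x(1,3,4) using x(2) sym
    by (simp add: g matrix_vector_right_distrib inner_add inner_commute algebra_simps)
qed

text \<open>Serves all three problems: for \<open>\<eta> = 0\<close> the condition on
  \<open>S\<close> is trivial and \<open>S\<close> may be the whole space, while otherwise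
  \<open>S\<close> lies in a level set of \<open>q \<bullet> x\<close>. The constant
  \<open>k\<close> absorbs the offset \<open>- P\<close> of \<open>h\<close>.\<close>

lemma constrained_quadratic_arg_min:
  fixes Q :: "real ^ 'k ^ 'k"
  assumes "transpose Q = Q" and pos: "\<And>x. x \<noteq> 0 \<Longrightarrow> x \<bullet> (Q *v x) > 0"
    and x0: "x0 = b - (1 / 2) *\<^sub>R (matrix_inv Q *v (g + \<eta> *\<^sub>R q))"
    and "S x0" and S: "\<And>x. S x \<Longrightarrow> \<eta> * (q \<bullet> x) = \<eta> * (q \<bullet> x0)"
  shows "{x. is_arg_min (\<lambda>x. (x - b) \<bullet> (Q *v (x - b)) + g \<bullet> x + k) S x} = {x0}"
proof (rule is_arg_min_eq_singleton)
  fix x assume "S x" "x \<noteq> x0"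
  have "2 *\<^sub>R (Q *v (x0 - b)) + (g + \<eta> *\<^sub>R q) = 0"
    using pos_def_mult_matrix_inv[OF pos, of "g + \<eta> *\<^sub>R q"]
    by (simp add: x0 vec.neg matrix_vector_mult_scaleR)
  \<comment> \<open>The expansion is used with linear coefficient
    \<open>g + \<eta> *\<^sub>R q\<close>; its \<open>\<eta>\<close> terms agree at \<open>x\<close>
    and \<open>x0\<close> and cancel.\<close>
  from quadratic_expand_stationary[OF assms(1) this, of x]
  have "(x - b) \<bullet> (Q *v (x - b)) + g \<bullet> x =
      (x0 - b) \<bullet> (Q *v (x0 - b)) + g \<bullet> x0 + (x - x0) \<bullet> (Q *v (x - x0))"
    using S[OF \<open>S x\<close>] by (simp add: inner_add_left)
  then show "(x0 - b) \<bullet> (Q *v (x0 - b)) + g \<bullet> x0 + k < (x - b) \<bullet> (Q *v (x - b)) + g \<bullet> x + k"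
    using pos[of "x - x0"] \<open>x \<noteq> x0\<close> by simp
qed fact

theorem proposition2:
  fixes wbar wtil :: "real ^ 'n"
    and \<rho> c q_tx q_rx q_proc P :: real
    and \<nu> :: "real ^ 'm"
    and A :: "real ^ ('n + 'n + unit) ^ 'm"
    and Q :: "real ^ ('n + 'n + unit) ^ ('n + 'n + unit)"
    and b q :: "real ^ ('n + 'n + unit)"
    and u h :: "real ^ ('n + 'n + unit) \<Rightarrow> real"
  assumes "\<rho> > 0" and "c > 0" and "q_tx > 0" and "q_rx > 0" and "q_proc > 0"
    and "b = stack wbar wtil 0"
    and "Q = diag_matrix (stack ((\<rho> / 2) *\<^sub>R 1) ((\<rho> / 2) *\<^sub>R 1) c)"
    and "q = stack ((q_tx - q_proc) *\<^sub>R 1) ((q_rx + q_proc) *\<^sub>R 1) 0"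
    and "u = (\<lambda>x. (x - b) \<bullet> (Q *v (x - b)) + \<nu> \<bullet> (A *v x))"
    and "h = (\<lambda>x. q \<bullet> x - P)"
  shows "{x. is_arg_min u (\<lambda>_. True) x} =
           {b - (1 / 2) *\<^sub>R (matrix_inv Q *v (transpose A *v \<nu>))} \<and>
         {x. is_arg_min (\<lambda>x. u x + h x) (\<lambda>_. True) x} =
           {b - (1 / 2) *\<^sub>R (matrix_inv Q *v (transpose A *v \<nu> + q))} \<and>
         {x. is_arg_min u (\<lambda>x. h x = 0) x} =
           {b - (1 / 2) *\<^sub>R (matrix_inv Q *v
              (transpose A *v \<nu> +
               (q \<bullet> ((1 / (norm q)\<^sup>2) *\<^sub>R
                  (2 *\<^sub>R (Q *v (b - (P / (norm q)\<^sup>2) *\<^sub>R q)) - transpose A *v \<nu>))) *\<^sub>R q))}"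
proof -
  define d :: "real ^ ('n + 'n + unit)" where "d = stack ((\<rho> / 2) *\<^sub>R 1) ((\<rho> / 2) *\<^sub>R 1) c"
  have Q: "Q = diag_matrix d"
    by (simp add: assms d_def)
  have d_pos: "d $ i > 0" for i
    using assms(1,2) by (auto simp: d_def stack_def split: sum.split)
  have sym: "transpose Q = Q"
    by (simp add: Q transpose_diag_matrix)
  have pos: "x \<bullet> (Q *v x) > 0" if "x \<noteq> 0" for x
    using diag_matrix_pos_def[of d x] d_pos that by (simp add: Q)
  define a where "a = transpose A *v \<nu>"
  have u: "u = (\<lambda>x. (x - b) \<bullet> (Q *v (x - b)) + a \<bullet> x + 0)"
    by (simp add: assms(9) a_def dot_lmul_matrix flip: vector_transpose_matrix)
  have uh: "(\<lambda>x. u x + h x) = (\<lambda>x. (x - b) \<bullet> (Q *v (x - b)) + (a + q) \<bullet> x + (- P))"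
    by (simp add: u assms(10) inner_add_left algebra_simps)

  \<comment> \<open>An entry of the reception block is chosen because \<open>q_tx - q_proc\<close>
    may be zero.\<close>
  have "q $ Inr (Inl undefined) > 0"
    using assms(4,5) by (simp add: assms(8) stack_def)
  then have "q \<noteq> 0"
    by auto
  \<comment> \<open>The only diagonal entry of \<open>Q\<close> other than \<open>\<rho> / 2\<close>
    is \<open>c\<close>, and it meets the zero slack entry of \<open>q\<close>.\<close>
  have Qq: "Q *v q = (\<rho> / 2) *\<^sub>R q"
    by (auto simp: vec_eq_iff Q diag_matrix_mult_nth d_def assms(8) stack_def split: sum.split)
  have q_Q: "q \<bullet> (Q *v v) = \<rho> / 2 * (q \<bullet> v)" for v
    by (metis Qq sym dot_lmul_matrix vector_transpose_matrix inner_scaleR_left)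
  have q_inv: "q \<bullet> (matrix_inv Q *v v) = 2 / \<rho> * (q \<bullet> v)" for v
    using q_Q[of "matrix_inv Q *v v"] pos_def_mult_matrix_inv[OF pos, of v] assms(1)
    by (simp add: field_simps)
  define \<eta> where "\<eta> = q \<bullet> ((1 / (norm q)\<^sup>2) *\<^sub>R (2 *\<^sub>R (Q *v (b - (P / (norm q)\<^sup>2) *\<^sub>R q)) - a))"
  \<comment> \<open>By \<open>q_Q\<close>, pairing \<open>q\<close> with
    \<open>2 *\<^sub>R (Q *v v)\<close> gives \<open>\<rho> * (q \<bullet> v)\<close>; the shift of
    \<open>b\<close> along \<open>q\<close> contributes exactly \<open>- P\<close>.\<close>
  have "\<eta> * (q \<bullet> q) = \<rho> * (q \<bullet> b - P) - q \<bullet> a"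
    using \<open>q \<noteq> 0\<close> by (simp add: \<eta>_def inner_diff_right q_Q power2_norm_eq_inner)
  \<comment> \<open>By \<open>q_inv\<close> the value of \<open>h\<close> here is \<open>q \<bullet>
    b - (q \<bullet> a + \<eta> * (q \<bullet> q)) / \<rho> - P\<close>, so the previous equation
    makes it vanish.\<close>
  then have feasible: "h (b - (1 / 2) *\<^sub>R (matrix_inv Q *v (a + \<eta> *\<^sub>R q))) = 0"
    using assms(1) by (simp add: assms(10) inner_diff_right inner_add_right q_inv field_simps)

  show ?thesis
    unfolding a_def[symmetric] \<eta>_def[symmetric] uh unfolding u
    using constrained_quadratic_arg_min[OF sym pos refl, where b=b and g=a and \<eta>=0 and q=0 and k=0 and S="\<lambda>_. True"]
      constrained_quadratic_arg_min[OF sym pos refl, where b=b and g="a + q" and \<eta>=0 and q=0 and k="- P" and S="\<lambda>_. True"]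
      constrained_quadratic_arg_min[OF sym pos refl, where b=b and g=a and \<eta>=\<eta> and q=q and k=0 and S="\<lambda>x. h x = 0"] feasible
    by (simp add: assms(10))
qed

end
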